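(* Let $1\le p\le\infty$, $\varphi\in\ell^\infty(\mathbb{Z})$, $\psi\in\ell^\infty(\mathbb{N})$, and assume that the matrix $A:=T(\varphi)+H(\psi)$ generates a bounded operator on $\ell^p(\mathbb{N}_0)$. Then $\varphi=\varphi_1+\varphi_2$, where $\varphi_1=\hat a$ is the Fourier sequence of a function $a\in M^p$ and $T(\varphi_2)$ is a checkerboard matrix. Moreover, $\psi=\psi_1+\psi_2$, where $H(\psi_1)$ is a bounded Hankel matrix (on $\ell^p(\mathbb{N}_0)$) with $\psi_1\in c_0(\mathbb{N})$ and $H(\psi_2)=-T(\varphi_2)$. Both decompositions are unique.
   Context: $\mathbb{N}=\{1,2,\dots\}$, $\mathbb{N}_0=\{0,1,2,\dots\}$. An infinite matrix $(A_{j,k})_{j,k\in J}$ (with $J=\mathbb{Z}$ or $\mathbb{N}_0$) generates a bounded linear operator on $\ell^p(J)$ if there is $c>0$ such that for each $x\in\ell^p(J)$ the sequence $y_j=\sum_{k\in J}A_{j,k}x_k$ is in $\ell^p(J)$ and $\|y\|\le c\|x\|$; such a matrix is called bounded. For sequences $\varphi=(\varphi_n)_{n\in\mathbb{Z}}$ and $\psi=(\psi_n)_{n\in\mathbb{N}}$: $L(\varphi)=(\varphi_{j-k})_{j,k\in\mathbb{Z}}$ (Laurent matrix), $T(\varphi)=(\varphi_{j-k})_{j,k\in\mathbb{N}_0}$ (Toeplitz matrix), $H(\psi)=(\psi_{j+k+1})_{j,k\in\mathbb{N}_0}$ (Hankel matrix). A matrix $(C_{j,k})_{j,k\in\mathbb{N}_0}$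 is a checkerboard matrix if $C_{j,k}=C_{j+1,k+1}$ for all $j,k\in\mathbb{N}_0$ and $C_{j,k}=C_{j+1,k-1}$ for all $j\in\mathbb{N}_0$, $k\in\mathbb{N}$. $c_0(\mathbb{N})$ is the space of sequences tending to $0$. For $a\in L^1$ of the unit circle, $\hat a=(\hat a_n)_{n\in\mathbb{Z}}$ is its sequence of Fourier coefficients. $M^p$ is the set of all $a\in L^1$ for which $L(\hat a)$ generates a bounded operator on $\ell^p(\mathbb{Z})$. *)

theory Defs
  imports "HOL-Analysis.Analysis"
begin

text \<open>
  Sequences indexed by a set \<open>J\<close> are functions on the ambient index type of which only the
  values on \<open>J\<close> matter. The index sets used are \<open>UNIV :: int set\<close>, \<open>UNIV :: nat set\<close> (the
  naturals with 0) and \<open>{1..} :: nat set\<close> (the positive naturals). The exponent \<open>p\<close> ranges over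
  \<open>ennreal\<close>, so that \<open>1 \<le> p\<close> covers all of $[1,\infty]$.
\<close>

definition ell :: "ennreal \<Rightarrow> 'i set \<Rightarrow> ('i \<Rightarrow> complex) set" where
  "ell p J = (if p = \<infinity> then {x. bdd_above ((\<lambda>j. norm (x j)) ` J)}
              else {x. (\<lambda>j. norm (x j) powr enn2real p) summable_on J})"

definition ell_norm :: "ennreal \<Rightarrow> 'i set \<Rightarrow> ('i \<Rightarrow> complex) \<Rightarrow> real" where
  "ell_norm p J x = (if p = \<infinity> then (SUP j\<in>J. norm (x j))
              else (\<Sum>\<^sub>\<infinity>j\<in>J. norm (x j) powr enn2real p) powr (1 / enn2real p))"

text \<open>
  The convergence of all row series, implicit in forming the image sequence, is made explicit
  (\<open>infsum\<close> is 0 for non-summable families). Unconditional summability is no restriction: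
  $\ell^p$ is closed under multiplication by unimodular sequences, so if the row series converge
  in the ordinary sense for all \<open>x\<close> in $\ell^p$ then they converge absolutely.
\<close>

definition bounded_matrix :: "ennreal \<Rightarrow> 'i set \<Rightarrow> ('i \<Rightarrow> 'i \<Rightarrow> complex) \<Rightarrow> bool" where
  "bounded_matrix p J A \<longleftrightarrow>
     (\<exists>c>0. \<forall>x\<in>ell p J.
        (\<forall>j\<in>J. (\<lambda>k. A j k * x k) summable_on J) \<and>
        (\<lambda>j. \<Sum>\<^sub>\<infinity>k\<in>J. A j k * x k) \<in> ell p J \<and>
        ell_norm p J (\<lambda>j. \<Sum>\<^sub>\<infinity>k\<in>J. A j k * x k) \<le> c * ell_norm p J x)"

definition laurent :: "(int \<Rightarrow> complex) \<Rightarrow> int \<Rightarrow> int \<Rightarrow> complex" where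
  "laurent \<phi> j k = \<phi> (j - k)"

definition toeplitz :: "(int \<Rightarrow> complex) \<Rightarrow> nat \<Rightarrow> nat \<Rightarrow> complex" where
  "toeplitz \<phi> j k = \<phi> (int j - int k)"

definition hankel :: "(nat \<Rightarrow> complex) \<Rightarrow> nat \<Rightarrow> nat \<Rightarrow> complex" where
  "hankel \<psi> j k = \<psi> (j + k + 1)"

definition checkerboard :: "(nat \<Rightarrow> nat \<Rightarrow> complex) \<Rightarrow> bool" where
  "checkerboard C \<longleftrightarrow>
     (\<forall>j k. C j k = C (j + 1) (k + 1)) \<and> (\<forall>j. \<forall>k\<ge>1. C j k = C (j + 1) (k - 1))"

text \<open>
  Functions on the unit circle are functions on \<open>complex\<close> of which only the values at \<open>cis t\<close>
  matter; elements of $L^1$ are given by representatives.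
\<close>

definition L1_circle :: "(complex \<Rightarrow> complex) set" where
  "L1_circle = {a. set_integrable lebesgue {0..2*pi} (\<lambda>t. a (cis t))}"

definition fourier_coeff :: "(complex \<Rightarrow> complex) \<Rightarrow> int \<Rightarrow> complex" where
  "fourier_coeff a n =
     (LINT t:{0..2*pi}|lebesgue. a (cis t) * cis (- (of_int n * t))) / of_real (2 * pi)"

definition multipliers :: "ennreal \<Rightarrow> (complex \<Rightarrow> complex) set" where
  "multipliers p = {a \<in> L1_circle. bounded_matrix p UNIV (laurent (fourier_coeff a))}"

definition toeplitz_decomp ::
  "ennreal \<Rightarrow> (int \<Rightarrow> complex) \<Rightarrow> (int \<Rightarrow> complex) \<Rightarrow> (int \<Rightarrow> complex) \<Rightarrow> bool" where
  "toeplitz_decomp p \<phi> \<phi>1 \<phi>2 \<longleftrightarrow>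
     (\<forall>n. \<phi> n = \<phi>1 n + \<phi>2 n) \<and>
     (\<exists>a\<in>multipliers p. \<phi>1 = fourier_coeff a) \<and>
     checkerboard (toeplitz \<phi>2)"

definition hankel_decomp ::
  "ennreal \<Rightarrow> (int \<Rightarrow> complex) \<Rightarrow> (nat \<Rightarrow> complex) \<Rightarrow> (nat \<Rightarrow> complex) \<Rightarrow> (nat \<Rightarrow> complex) \<Rightarrow> bool" where
  "hankel_decomp p \<phi>2 \<psi> \<psi>1 \<psi>2 \<longleftrightarrow>
     (\<forall>n\<ge>1. \<psi> n = \<psi>1 n + \<psi>2 n) \<and>
     bounded_matrix p UNIV (hankel \<psi>1) \<and>
     \<psi>1 \<longlonglongrightarrow> 0 \<and>
     (\<forall>j k. hankel \<psi>2 j k = - toeplitz \<phi>2 j k)"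

end

theory Submission
  imports Defs
begin

text \<open>
  Down the diagonals of $A = T(\varphi) + H(\psi)$ the Toeplitz part is constant, while the Hankel
  part runs through $\psi$ in steps of two. All diagonal translates of \<open>A\<close> have the
  bound of \<open>A\<close>, hence so have their averages and the limits of these. Since $\psi$ is
  bounded, a subsequence of the averages of $\psi$ over each parity class converges, and the limit
  of the averaged matrices is $T(\varphi) + (\kappa_{j+k})$ with $\kappa$ of period 2
  (\<open>toeplitz_part_section_bounded\<close>). Because $j + k$ and $j - k$ have the same parity, this is the
  Toeplitz matrix of $\varphi_1 = \varphi + \kappa$. So $T(\varphi_1)$ is bounded, and with it
  $L(\varphi_1)$, whose finite windows are windows of $T(\varphi_1)$
  (\<open>laurent_section_bounded_if_toeplitz\<close>). The rest, $\varphi_2 = - \kappa$, has period 2, which is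
  the checkerboard property, and $H(\psi_1) = A - T(\varphi_1)$ is bounded.

  That $\varphi_1$ is a Fourier sequence comes from $\ell^2$: for $p \le 2$ a column, and for
  $p \ge 2$ a row, of a bounded matrix is square summable (\<open>section_bounded_row_or_column_l2\<close>). In
  a Laurent or Hankel matrix either of them exhibits the defining sequence. Hence
  $\varphi_1 \in \ell^2$ is the Fourier sequence of an integrable function by the Riesz--Fischer theorem
  (\<open>riesz_fischer_L1\<close>), and $\psi_1$ tends to 0.

  The same square summability gives uniqueness: two choices of $\varphi_2$ differ by a
  sequence of period 2 that tends to 0, hence by 0 (\<open>l2_plus_periodic_unique\<close>), and
  $\psi_2$ is prescribed by $\varphi_2$.
\<close>

section \<open>Balls of $\ell^p$\<close>
lemma enn2real_ge_one: "1 \<le> p \<Longrightarrow> p \<noteq> \<infinity> \<Longrightarrow> 1 \<le> enn2real p" for p :: ennreal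
  using enn2real_mono[of 1 p] by (simp add: less_top)

lemma convex_on_powr_nonneg:
  fixes p :: real
  assumes "1 \<le> p"
  shows "convex_on {0..} (\<lambda>t. t powr p)"
proof (rule convex_on_linorderI)
  fix t x y :: real
  assume t: "0 < t" "t < 1" and x: "x \<in> {0..}" and y: "y \<in> {0..}" and less: "x < y"
  show "((1 - t) *\<^sub>R x + t *\<^sub>R y) powr p \<le> (1 - t) * x powr p + t * y powr p"
  proof (cases "x = 0")
    case True
    have "t powr p \<le> t powr 1"
      using assms t by (intro powr_mono') auto
    then show ?thesis
      using True t y by (simp add: powr_mult mult_right_mono)
  next
    case False
    then have "x \<in> {0<..}" "y \<in> {0<..}" using x less by auto
    then show ?thesis
      using convex_onD[OF powr_convex[OF assms], of t x y] t by auto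
  qed
qed auto

text \<open>
  The closed ball of radius \<open>r\<close> in $\ell^p(J)$, written without infinite sums: membership is
  a family of closed conditions, each on finitely many coordinates, uniformly for all
  \<open>p\<close> including $\infty$. Passing to coordinatewise limits is then immediate, which norms
  defined by \<open>infsum\<close> and \<open>SUP\<close> do not allow so directly.
\<close>
definition lp_ball :: "ennreal \<Rightarrow> 'i set \<Rightarrow> real \<Rightarrow> ('i \<Rightarrow> complex) \<Rightarrow> bool" where
  "lp_ball p J r x \<longleftrightarrow> 0 \<le> r \<and>
     (if p = \<infinity> then \<forall>j\<in>J. norm (x j) \<le> r
      else \<forall>F. finite F \<and> F \<subseteq> J \<longrightarrow>
             (\<Sum>j\<in>F. norm (x j) powr enn2real p) \<le> r powr enn2real p)"

lemma lp_ball_radius_nonneg: "lp_ball p J r x \<Longrightarrow> 0 \<le> r"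
  by (simp add: lp_ball_def)

lemma lp_ball_coordinate:
  assumes "1 \<le> p" "lp_ball p J r x" "j \<in> J"
  shows "norm (x j) \<le> r"
proof (cases "p = \<infinity>")
  case False
  have "(\<Sum>j\<in>{j}. norm (x j) powr enn2real p) \<le> r powr enn2real p"
    using assms False unfolding lp_ball_def by (metis empty_subsetI finite.emptyI finite.insertI insert_subset)
  moreover have "0 < enn2real p" using enn2real_ge_one[OF assms(1) False] by simp
  ultimately show ?thesis
    using powr_less_mono2[of "enn2real p" r "norm (x j)"] lp_ball_radius_nonneg[OF assms(2)]
    by (fastforce simp: not_le[symmetric])
qed (use assms in \<open>auto simp: lp_ball_def\<close>)

lemma lp_ball_norm_mono:
  assumes "1 \<le> p" "lp_ball p J r x" "\<And>j. j \<in> J \<Longrightarrow> norm (y j) \<le> norm (x j)" 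
  shows "lp_ball p J r y"
proof (cases "p = \<infinity>")
  case True
  then show ?thesis using assms by (force simp: lp_ball_def)
next
  case False
  have "(\<Sum>j\<in>F. norm (y j) powr enn2real p) \<le> r powr enn2real p" if "finite F" "F \<subseteq> J" for F
  proof -
    have "(\<Sum>j\<in>F. norm (y j) powr enn2real p) \<le> (\<Sum>j\<in>F. norm (x j) powr enn2real p)"
      using assms that enn2real_ge_one[OF assms(1) False] by (intro sum_mono powr_mono2) auto
    also have "\<dots> \<le> r powr enn2real p" using assms that False by (auto simp: lp_ball_def)
    finally show ?thesis .
  qed
  then show ?thesis using False lp_ball_radius_nonneg[OF assms(2)] by (auto simp: lp_ball_def)
qed

lemma lp_ball_scale:
  assumes "lp_ball p J r x"
  shows "lp_ball p J (norm c * r) (\<lambda>j. c * x j)"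
  using assms
  by (auto simp: lp_ball_def norm_mult powr_mult mult_left_mono simp flip: sum_distrib_left)

lemma lp_ball_radius_mono:
  assumes "lp_ball p J r x" "r \<le> s"
  shows "lp_ball p J s x"
proof (cases "p = \<infinity>")
  case False
  have "r powr enn2real p \<le> s powr enn2real p"
    using assms by (intro powr_mono2) (auto simp: lp_ball_def)
  then show ?thesis
    using assms False unfolding lp_ball_def by (meson order_trans)
next
  case True
  then show ?thesis
    using assms unfolding lp_ball_def by (meson order_trans)
qed

lemma lp_ball_reindex:
  assumes "lp_ball p J r x" "inj_on g I" "g ` I \<subseteq> J"
  shows "lp_ball p I r (\<lambda>i. x (g i))"
proof (cases "p = \<infinity>")
  case False
  have "(\<Sum>i\<in>F. norm (x (g i)) powr enn2real p) \<le> r powr enn2real p" if "finite F" "F \<subseteq> I" for F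
  proof -
    have "(\<Sum>i\<in>F. norm (x (g i)) powr enn2real p) = (\<Sum>j\<in>g ` F. norm (x j) powr enn2real p)"
      using inj_on_subset[OF assms(2) that(2)] by (simp add: sum.reindex)
    also have "finite (g ` F)" "g ` F \<subseteq> J" using assms(3) that by auto
    then have "(\<Sum>j\<in>g ` F. norm (x j) powr enn2real p) \<le> r powr enn2real p"
      using assms(1) False by (simp add: lp_ball_def)
    finally show ?thesis .
  qed
  then show ?thesis using False assms by (auto simp: lp_ball_def)
qed (use assms in \<open>auto simp: lp_ball_def\<close>)

lemma lp_ball_extend_by_zero:
  assumes "1 \<le> p" "lp_ball p K r x"
  shows "lp_ball p J r (\<lambda>k. if k \<in> K then x k else 0)"
proof (cases "p = \<infinity>")
  case False
  have "(\<Sum>k\<in>F. norm (if k \<in> K then x k else 0) powr enn2real p) \<le> r powr enn2real p"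
    if "finite F" for F
  proof -
    have "(\<Sum>k\<in>F. norm (if k \<in> K then x k else 0) powr enn2real p)
        = (\<Sum>k\<in>F \<inter> K. norm (x k) powr enn2real p)"
      using that by (intro sum.mono_neutral_cong_right) auto
    also have "\<dots> \<le> r powr enn2real p" using assms that False by (auto simp: lp_ball_def)
    finally show ?thesis .
  qed
  then show ?thesis using False assms by (auto simp: lp_ball_def)
qed (use assms in \<open>auto simp: lp_ball_def\<close>)

text \<open>
  The Fatou property of $\ell^p$: balls are closed under coordinatewise convergence.
\<close>
lemma lp_ball_tendsto:
  assumes "1 \<le> p" "G \<noteq> bot" "\<forall>\<^sub>F i in G. lp_ball p J r (f i)"
    and lim: "\<And>j. j \<in> J \<Longrightarrow> ((\<lambda>i. f i j) \<longlongrightarrow> x j) G"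
  shows "lp_ball p J r x"
proof -
  have r: "0 \<le> r" using eventually_happens[OF assms(3)] assms(2) by (auto simp: lp_ball_def)
  show ?thesis
  proof (cases "p = \<infinity>")
    case True
    have "norm (x j) \<le> r" if "j \<in> J" for j
      using tendsto_norm[OF lim[OF that]]
      by (rule tendsto_upperbound)
         (use assms(2,3) True that in \<open>auto simp: lp_ball_def elim: eventually_mono\<close>)
    then show ?thesis using r True by (simp add: lp_ball_def)
  next
    case False
    have P: "1 \<le> enn2real p" using enn2real_ge_one[OF assms(1) False] .
    have "(\<Sum>j\<in>F. norm (x j) powr enn2real p) \<le> r powr enn2real p" if "finite F" "F \<subseteq> J" for F
    proof (rule tendsto_upperbound)
      show "((\<lambda>i. \<Sum>j\<in>F. norm (f i j) powr enn2real p)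
              \<longlongrightarrow> (\<Sum>j\<in>F. norm (x j) powr enn2real p)) G"
        using that P lim by (intro tendsto_sum tendsto_powr' tendsto_norm tendsto_const) auto
      show "\<forall>\<^sub>F i in G. (\<Sum>j\<in>F. norm (f i j) powr enn2real p) \<le> r powr enn2real p"
        using assms(3) by eventually_elim (use that False in \<open>auto simp: lp_ball_def\<close>)
    qed fact
    then show ?thesis using r False by (auto simp: lp_ball_def)
  qed
qed

text \<open>
  Balls are convex. For finite \<open>p\<close> this is Jensen's inequality for \<open>t powr p\<close>, applied
  in each coordinate and then summed, so that Minkowski's inequality is avoided.
\<close>
lemma lp_ball_average:
  assumes "1 \<le> p" "finite S" "S \<noteq> {}" "\<And>i. i \<in> S \<Longrightarrow> lp_ball p J r (f i)"
  shows "lp_ball p J r (\<lambda>j. (\<Sum>i\<in>S. f i j) / of_nat (card S))"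
proof -
  have r: "0 \<le> r" using assms(3,4) lp_ball_radius_nonneg by blast
  have N: "0 < real (card S)" using assms by (simp add: card_gt_0_iff)
  have avg: "norm ((\<Sum>i\<in>S. f i j) / of_nat (card S)) \<le> (\<Sum>i\<in>S. (1 / card S) *\<^sub>R norm (f i j))" for j
    using norm_sum[of "\<lambda>i. f i j" S] N
    by (simp add: norm_divide divide_right_mono flip: sum_divide_distrib)
  show ?thesis
  proof (cases "p = \<infinity>")
    case True
    have "norm ((\<Sum>i\<in>S. f i j) / of_nat (card S)) \<le> r" if "j \<in> J" for j
    proof -
      have "(\<Sum>i\<in>S. (1 / card S) *\<^sub>R norm (f i j)) \<le> (\<Sum>i\<in>S. (1 / card S) * r)"
        using assms(4) that True by (intro sum_mono) (auto simp: lp_ball_def divide_right_mono)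
      then show ?thesis using avg[of j] N by simp
    qed
    then show ?thesis using r True by (simp add: lp_ball_def)
  next
    case False
    have P: "1 \<le> enn2real p" using enn2real_ge_one[OF assms(1) False] .
    have "(\<Sum>j\<in>F. norm ((\<Sum>i\<in>S. f i j) / of_nat (card S)) powr enn2real p) \<le> r powr enn2real p"
      if F: "finite F" "F \<subseteq> J" for F
    proof -
      have "(\<Sum>j\<in>F. norm ((\<Sum>i\<in>S. f i j) / of_nat (card S)) powr enn2real p)
          \<le> (\<Sum>j\<in>F. \<Sum>i\<in>S. (1 / card S) * norm (f i j) powr enn2real p)"
      proof (rule sum_mono)
        fix j
        have "norm ((\<Sum>i\<in>S. f i j) / of_nat (card S)) powr enn2real p
            \<le> (\<Sum>i\<in>S. (1 / card S) *\<^sub>R norm (f i j)) powr enn2real p"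
          using avg[of j] P by (intro powr_mono2) auto
        also have "\<dots> \<le> (\<Sum>i\<in>S. (1 / card S) * norm (f i j) powr enn2real p)"
          using assms(2,3) N by (intro convex_on_sum[OF _ _ convex_on_powr_nonneg[OF P]]) auto
        finally show "norm ((\<Sum>i\<in>S. f i j) / of_nat (card S)) powr enn2real p
            \<le> (\<Sum>i\<in>S. (1 / card S) * norm (f i j) powr enn2real p)" .
      qed
      also have "\<dots> = (\<Sum>i\<in>S. (1 / card S) * (\<Sum>j\<in>F. norm (f i j) powr enn2real p))"
        by (subst sum.swap) (simp add: sum_distrib_left)
      also have "\<dots> \<le> (\<Sum>i\<in>S. (1 / card S) * r powr enn2real p)"
        using assms(4) F False by (intro sum_mono mult_left_mono) (auto simp: lp_ball_def)
      also have "\<dots> = r powr enn2real p" using N by simp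
      finally show ?thesis .
    qed
    then show ?thesis using r False by (auto simp: lp_ball_def)
  qed
qed

text \<open>
  A quasi-triangle inequality, read off from convexity: \<open>x - y\<close> is twice the average of
  \<open>x\<close> and \<open>- y\<close>. The factor 2 is harmless, as only boundedness is at stake.
\<close>
lemma lp_ball_diff:
  assumes "1 \<le> p" "lp_ball p J r x" "lp_ball p J s y"
  shows "lp_ball p J (2 * (r + s)) (\<lambda>j. x j - y j)"
proof -
  have "0 \<le> r" "0 \<le> s" using assms lp_ball_radius_nonneg by blast+
  then have "lp_ball p J (r + s) x" "lp_ball p J (r + s) (\<lambda>j. - y j)"
    using assms lp_ball_radius_mono lp_ball_scale[OF assms(3), of "- 1"] by fastforce+
  then have "lp_ball p J (r + s) (\<lambda>j. if b then x j else - y j)" for b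
    by (cases b) simp_all
  then have "lp_ball p J (r + s)
      (\<lambda>j. (\<Sum>b\<in>UNIV. if b then x j else - y j) / of_nat (card (UNIV :: bool set)))"
    using assms(1) by (intro lp_ball_average) auto
  from lp_ball_scale[OF this, of 2] show ?thesis
    by (simp add: UNIV_bool diff_divide_distrib)
qed

text \<open>
  The embedding $\ell^p \subseteq \ell^q$ for $p \le q$, with norm one: each coordinate is at most
  \<open>r\<close>, so the surplus power \<open>q - p\<close> can be estimated by that of \<open>r\<close>.
\<close>
lemma lp_ball_exponent_mono:
  assumes "1 \<le> p" "p \<le> q" "lp_ball p J r x"
  shows "lp_ball q J r x"
proof (cases "q = \<infinity>")
  case True
  then show ?thesis
    using lp_ball_coordinate[OF assms(1,3)] lp_ball_radius_nonneg[OF assms(3)]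
    by (simp add: lp_ball_def)
next
  case False
  then have p: "p \<noteq> \<infinity>" using assms(2) by (auto simp: top_unique)
  have pq: "enn2real p \<le> enn2real q" using enn2real_mono[OF assms(2)] False by (simp add: less_top)
  have r: "0 \<le> r" using lp_ball_radius_nonneg[OF assms(3)] .
  have split: "t powr enn2real q = t powr (enn2real q - enn2real p) * t powr enn2real p" for t :: real
    by (simp flip: powr_add)
  have "(\<Sum>j\<in>F. norm (x j) powr enn2real q) \<le> r powr enn2real q" if F: "finite F" "F \<subseteq> J" for F
  proof -
    have "(\<Sum>j\<in>F. norm (x j) powr enn2real q)
        \<le> (\<Sum>j\<in>F. r powr (enn2real q - enn2real p) * norm (x j) powr enn2real p)"
      unfolding split[of "norm _"] using lp_ball_coordinate[OF assms(1,3)] F pq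
      by (intro sum_mono mult_right_mono powr_mono2) auto
    also have "\<dots> \<le> r powr (enn2real q - enn2real p) * r powr enn2real p"
      using assms(3) F p unfolding sum_distrib_left[symmetric]
      by (intro mult_left_mono) (auto simp: lp_ball_def)
    finally show ?thesis unfolding split[of r] .
  qed
  then show ?thesis using r False by (auto simp: lp_ball_def)
qed

lemma lp_ball_if_finite_parts:
  assumes "0 \<le> r" "\<And>F. finite F \<Longrightarrow> F \<subseteq> J \<Longrightarrow> lp_ball p F r x"
  shows "lp_ball p J r x"
proof (cases "p = \<infinity>")
  case True
  have "norm (x j) \<le> r" if "j \<in> J" for j
    using assms(2)[of "{j}"] that True by (simp add: lp_ball_def)
  then show ?thesis using True assms(1) by (simp add: lp_ball_def)
next
  case False
  have "(\<Sum>j\<in>F. norm (x j) powr enn2real p) \<le> r powr enn2real p" if "finite F" "F \<subseteq> J" for F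
    using assms(2)[OF that] that False by (auto simp: lp_ball_def)
  then show ?thesis using False assms(1) by (simp add: lp_ball_def)
qed

lemma lp_ball_iff_ell_norm:
  assumes "1 \<le> p" "J \<noteq> {}"
  shows "lp_ball p J r x \<longleftrightarrow> x \<in> ell p J \<and> ell_norm p J x \<le> r"
proof (cases "p = \<infinity>")
  case True
  show ?thesis
  proof
    assume "lp_ball p J r x"
    then show "x \<in> ell p J \<and> ell_norm p J x \<le> r"
      using True assms(2) by (auto simp: lp_ball_def ell_def ell_norm_def intro!: cSUP_least bdd_aboveI2)
  next
    assume *: "x \<in> ell p J \<and> ell_norm p J x \<le> r"
    then have le: "norm (x j) \<le> r" if "j \<in> J" for j
      using True cSUP_upper[OF that, of "\<lambda>j. norm (x j)"] by (auto simp: ell_def ell_norm_def)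
    then have "0 \<le> r" using assms(2) norm_ge_zero order_trans by blast
    then show "lp_ball p J r x" using le True by (simp add: lp_ball_def)
  qed
next
  case False
  define P where "P = enn2real p"
  have P: "1 \<le> P" using enn2real_ge_one[OF assms(1) False] by (simp add: P_def)
  let ?f = "\<lambda>j. norm (x j) powr P"
  have root: "S powr (1 / P) \<le> r \<longleftrightarrow> S \<le> r powr P" if "0 \<le> S" "0 \<le> r" for S
  proof
    assume "S powr (1 / P) \<le> r"
    then have "(S powr (1 / P)) powr P \<le> r powr P" using P by (intro powr_mono2) auto
    then show "S \<le> r powr P" using P that by (simp add: powr_powr)
  next
    assume "S \<le> r powr P"
    then have "S powr (1 / P) \<le> (r powr P) powr (1 / P)" using P that by (intro powr_mono2) auto
    then show "S powr (1 / P) \<le> r" using P that by (simp add: powr_powr)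
  qed
  show ?thesis
  proof
    assume *: "lp_ball p J r x"
    then have sums: "sum ?f F \<le> r powr P" if "finite F" "F \<subseteq> J" for F
      using that False by (auto simp: lp_ball_def P_def)
    then have summ: "?f summable_on J"
      by (intro nonneg_bdd_above_summable_on) (auto intro!: bdd_aboveI2)
    have "infsum ?f J \<le> r powr P" using infsum_le_finite_sums[OF summ] sums by auto
    moreover have "0 \<le> infsum ?f J" by (intro infsum_nonneg) auto
    ultimately show "x \<in> ell p J \<and> ell_norm p J x \<le> r"
      using summ root[of "infsum ?f J"] lp_ball_radius_nonneg[OF *] False
      by (simp add: ell_def ell_norm_def P_def)
  next
    assume *: "x \<in> ell p J \<and> ell_norm p J x \<le> r"
    then have summ: "?f summable_on J" and nrm: "infsum ?f J powr (1 / P) \<le> r"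
      using False by (auto simp: ell_def ell_norm_def P_def)
    have r: "0 \<le> r" using nrm by (meson order_trans powr_ge_zero)
    have "0 \<le> infsum ?f J" by (intro infsum_nonneg) auto
    then have "infsum ?f J \<le> r powr P" using root[of "infsum ?f J"] nrm r by simp
    then have "sum ?f F \<le> r powr P" if "finite F" "F \<subseteq> J" for F
      using finite_sum_le_infsum[OF summ that] by auto
    then show "lp_ball p J r x" using r False by (auto simp: lp_ball_def P_def)
  qed
qed

section \<open>Bounded matrices through their finite sections\<close>

text \<open>
  Boundedness tested on finitely many columns only. No row series occurs, so the property
  passes to submatrices, averages and entrywise limits with the same constant.
\<close>
definition section_bounded :: "ennreal \<Rightarrow> ('i \<Rightarrow> 'i \<Rightarrow> complex) \<Rightarrow> real \<Rightarrow> bool" where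
  "section_bounded p A c \<longleftrightarrow> 0 \<le> c \<and>
     (\<forall>K x r. finite K \<longrightarrow> lp_ball p K r x \<longrightarrow> lp_ball p UNIV (c * r) (\<lambda>j. \<Sum>k\<in>K. A j k * x k))"

lemma section_boundedD:
  "section_bounded p A c \<Longrightarrow> finite K \<Longrightarrow> lp_ball p K r x \<Longrightarrow>
     lp_ball p UNIV (c * r) (\<lambda>j. \<Sum>k\<in>K. A j k * x k)"
  by (simp add: section_bounded_def)

text \<open>
  From finite sections to all of $\ell^p$: rotating the phases of the coordinates of \<open>x\<close> so that
  all \<open>A j k * x k\<close> become nonnegative turns the bound on finite sections into absolute
  convergence of row \<open>j\<close>; the bound on the image is then a coordinatewise limit.
\<close>
lemma bounded_matrix_iff_section_bounded:
  assumes p: "1 \<le> p"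
  shows "bounded_matrix p UNIV A \<longleftrightarrow> (\<exists>c. section_bounded p A c)"
proof
  assume "bounded_matrix p UNIV A"
  then obtain c where c: "0 < c"
    "\<And>x. x \<in> ell p UNIV \<Longrightarrow> (\<lambda>j. \<Sum>\<^sub>\<infinity>k. A j k * x k) \<in> ell p UNIV \<and>
           ell_norm p UNIV (\<lambda>j. \<Sum>\<^sub>\<infinity>k. A j k * x k) \<le> c * ell_norm p UNIV x"
    unfolding bounded_matrix_def by blast
  have "lp_ball p UNIV (c * r) (\<lambda>j. \<Sum>k\<in>K. A j k * x k)" if K: "finite K" "lp_ball p K r x" for K x r
  proof -
    let ?x = "\<lambda>k. if k \<in> K then x k else 0"
    have x: "?x \<in> ell p UNIV" "ell_norm p UNIV ?x \<le> r"
      using lp_ball_extend_by_zero[OF p K(2), of UNIV] lp_ball_iff_ell_norm[OF p] by blast+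
    have eq: "(\<Sum>\<^sub>\<infinity>k. A j k * ?x k) = (\<Sum>k\<in>K. A j k * x k)" for j
    proof -
      have "(\<Sum>\<^sub>\<infinity>k. A j k * ?x k) = (\<Sum>\<^sub>\<infinity>k\<in>K. A j k * x k)"
        by (rule infsum_cong_neutral) auto
      then show ?thesis using K by simp
    qed
    have "c * ell_norm p UNIV ?x \<le> c * r" using x c(1) by simp
    then show ?thesis
      using c(2)[OF x(1)] unfolding eq by (subst lp_ball_iff_ell_norm[OF p]) auto
  qed
  then show "\<exists>c. section_bounded p A c" using c(1) unfolding section_bounded_def by (intro exI[of _ c]) auto
next
  assume "\<exists>c. section_bounded p A c"
  then obtain c where c: "section_bounded p A c" by blast
  then have c0: "0 \<le> c" by (simp add: section_bounded_def)
  show "bounded_matrix p UNIV A"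
    unfolding bounded_matrix_def
  proof (intro exI[of _ "c + 1"] conjI ballI)
    fix x :: "'a \<Rightarrow> complex" assume x: "x \<in> ell p UNIV"
    define r where "r = ell_norm p UNIV x"
    have ball: "lp_ball p UNIV r x" using x lp_ball_iff_ell_norm[OF p] by (auto simp: r_def)
    have ballK: "lp_ball p K r x" for K using lp_ball_reindex[OF ball, of "\<lambda>k. k" K] by auto
    have summ: "(\<lambda>k. A j k * x k) summable_on UNIV" for j
    proof (rule abs_summable_summable, rule nonneg_bdd_above_summable_on)
      show "bdd_above (sum (\<lambda>k. norm (A j k * x k)) ` {F. F \<subseteq> UNIV \<and> finite F})"
      proof (rule bdd_aboveI2[where M = "c * r"])
        fix K :: "'a set" assume "K \<in> {F. F \<subseteq> UNIV \<and> finite F}"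
        then have K: "finite K" by simp
        let ?y = "\<lambda>k. cnj (sgn (A j k * x k)) * x k"
        have "lp_ball p K r ?y"
          by (rule lp_ball_norm_mono[OF p ballK]) (auto simp: norm_mult norm_sgn)
        then have "norm (\<Sum>k\<in>K. A j k * ?y k) \<le> c * r"
          using lp_ball_coordinate[OF p section_boundedD[OF c K]] by blast
        moreover have "A j k * ?y k = of_real (norm (A j k * x k))" for k
        proof -
          have "A j k * ?y k = (A j k * x k) * cnj (A j k * x k) / of_real (norm (A j k * x k))"
            by (simp add: sgn_eq mult_ac)
          also have "\<dots> = of_real (norm (A j k * x k))"
            by (subst complex_norm_square[symmetric]) (simp add: power2_eq_square)
          finally show ?thesis .
        qed
        ultimately have "norm (\<Sum>k\<in>K. of_real (norm (A j k * x k)) :: complex) \<le> c * r" by simp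
        moreover have "0 \<le> (\<Sum>k\<in>K. norm (A j k * x k))" by (intro sum_nonneg) auto
        ultimately show "(\<Sum>k\<in>K. norm (A j k * x k)) \<le> c * r"
          by (simp only: of_real_sum[symmetric] norm_of_real)
      qed
    qed auto
    then show "(\<lambda>k. A j k * x k) summable_on UNIV" for j .
    have "lp_ball p UNIV (c * r) (\<lambda>j. \<Sum>\<^sub>\<infinity>k. A j k * x k)"
    proof (rule lp_ball_tendsto[OF p, where G = "finite_subsets_at_top UNIV"])
      show "\<forall>\<^sub>F K in finite_subsets_at_top UNIV. lp_ball p UNIV (c * r) (\<lambda>j. \<Sum>k\<in>K. A j k * x k)"
        using section_boundedD[OF c _ ballK]
        by (intro eventually_finite_subsets_at_top_weakI) auto
    qed (auto intro: infsum_tendsto summ)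
    then have "lp_ball p UNIV ((c + 1) * r) (\<lambda>j. \<Sum>\<^sub>\<infinity>k. A j k * x k)"
      by (rule lp_ball_radius_mono)
         (use lp_ball_radius_nonneg[OF ball] c0 in \<open>auto simp: algebra_simps\<close>)
    then show "(\<lambda>j. \<Sum>\<^sub>\<infinity>k. A j k * x k) \<in> ell p UNIV"
      "ell_norm p UNIV (\<lambda>j. \<Sum>\<^sub>\<infinity>k. A j k * x k) \<le> (c + 1) * ell_norm p UNIV x"
      using lp_ball_iff_ell_norm[OF p] by (auto simp: r_def)
  qed (use c0 in auto)
qed

lemma section_bounded_diff:
  fixes A B :: "'i \<Rightarrow> 'i \<Rightarrow> complex"
  assumes "1 \<le> p" "section_bounded p A c" "section_bounded p B d"
  shows "section_bounded p (\<lambda>j k. A j k - B j k) (2 * (c + d))"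
  unfolding section_bounded_def
proof (intro conjI allI impI)
  show "0 \<le> 2 * (c + d)" using assms by (simp add: section_bounded_def)
  fix K :: "'i set" and x r assume K: "finite K" "lp_ball p K r x"
  from lp_ball_diff[OF assms(1) section_boundedD[OF assms(2) K] section_boundedD[OF assms(3) K]]
  show "lp_ball p UNIV (2 * (c + d) * r) (\<lambda>j. \<Sum>k\<in>K. (A j k - B j k) * x k)"
    by (simp add: algebra_simps sum_subtractf)
qed

text \<open>
  For $p \le 2$ the column is the image of a unit vector, hence in $\ell^p \subseteq \ell^2$. For
  $p \ge 2$ the row is a bounded functional on $\ell^p \supseteq \ell^2$, and testing it on its own
  conjugate, cut off to a finite set, bounds its $\ell^2$ norm. For matrices with constant
  (anti)diagonals a row and a column carry the same information, so this lemma
  replaces an interpolation argument.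
\<close>
lemma section_bounded_row_or_column_l2:
  assumes p: "1 \<le> p" and A: "section_bounded p A c"
  shows "(\<lambda>j. (norm (A j i))\<^sup>2) summable_on UNIV \<or> (\<lambda>k. (norm (A i k))\<^sup>2) summable_on UNIV"
proof -
  have ball2: "lp_ball 2 J r x \<longleftrightarrow> 0 \<le> r \<and> (\<forall>F. finite F \<and> F \<subseteq> J \<longrightarrow> (\<Sum>j\<in>F. (norm (x j))\<^sup>2) \<le> r\<^sup>2)"
    for J :: "'a set" and r x
    by (auto simp: lp_ball_def)
  have summ: "f summable_on UNIV" if "\<And>F. finite F \<Longrightarrow> sum f F \<le> B" "\<And>x. 0 \<le> f x"
    for f :: "'a \<Rightarrow> real" and B
    using that by (intro nonneg_bdd_above_summable_on) (auto intro!: bdd_aboveI2)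
  show ?thesis
  proof (cases "p \<le> 2")
    case True
    have "lp_ball p {i} 1 (\<lambda>_. 1)"
      by (rule lp_ball_exponent_mono[of 1]) (auto simp: lp_ball_def subset_singleton_iff p)
    from section_boundedD[OF A _ this] have "lp_ball p UNIV c (\<lambda>j. A j i)" by simp
    from lp_ball_exponent_mono[OF p True this] have "lp_ball 2 UNIV c (\<lambda>j. A j i)" .
    then show ?thesis using summ[of "\<lambda>j. (norm (A j i))\<^sup>2" "c\<^sup>2"] by (auto simp: ball2)
  next
    case False
    have "(\<Sum>k\<in>F. (norm (A i k))\<^sup>2) \<le> c\<^sup>2" if F: "finite F" for F
    proof -
      define S where "S = (\<Sum>k\<in>F. (norm (A i k))\<^sup>2)"
      have S: "0 \<le> S" by (auto simp: S_def intro: sum_nonneg)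
      have "lp_ball 2 F (sqrt S) (\<lambda>k. cnj (A i k))"
        unfolding ball2 using S F by (auto simp: S_def intro: sum_mono2)
      then have "lp_ball p F (sqrt S) (\<lambda>k. cnj (A i k))"
        by (rule lp_ball_exponent_mono[rotated 2]) (use False in auto)
      from lp_ball_coordinate[OF p section_boundedD[OF A F this], of i]
      have "norm (\<Sum>k\<in>F. A i k * cnj (A i k)) \<le> c * sqrt S" by simp
      moreover have "(\<Sum>k\<in>F. A i k * cnj (A i k)) = of_real S"
        by (simp add: S_def complex_norm_square[symmetric])
      ultimately have "sqrt S * sqrt S \<le> c * sqrt S" using S by simp
      moreover have "0 \<le> c" using A by (simp add: section_bounded_def)
      ultimately have "sqrt S \<le> c"
        using S mult_right_le_imp_le[of "sqrt S" "sqrt S" c] by (cases "S = 0") (auto simp: less_le)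
      then show ?thesis using S \<open>0 \<le> c\<close> by (metis S_def real_sqrt_le_iff real_sqrt_unique)
    qed
    then show ?thesis using summ[of "\<lambda>k. (norm (A i k))\<^sup>2" "c\<^sup>2"] by auto
  qed
qed

text \<open>
  Injectivity is asked for only on the finite sets of rows and columns in use, so that an
  integer window can be shifted into the naturals although no translation maps
  all integers there.
\<close>
lemma section_bounded_submatrix:
  fixes A :: "'i \<Rightarrow> 'i \<Rightarrow> complex"
  assumes "1 \<le> p" "section_bounded p A c" "inj_on f F" "inj_on g K" "finite K" "lp_ball p K r x"
  shows "lp_ball p F (c * r) (\<lambda>j. \<Sum>k\<in>K. A (f j) (g k) * x k)"
proof -
  let ?h = "the_inv_into K g"
  have "lp_ball p (g ` K) r (\<lambda>k. x (?h k))"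
    using assms by (intro lp_ball_reindex[OF assms(6)]) (auto simp: inj_on_the_inv_into the_inv_into_f_f)
  from section_boundedD[OF assms(2) _ this]
  have "lp_ball p UNIV (c * r) (\<lambda>j. \<Sum>k\<in>g ` K. A j k * x (?h k))" using assms by simp
  from lp_ball_reindex[OF this assms(3)]
  have "lp_ball p F (c * r) (\<lambda>j. \<Sum>k\<in>g ` K. A (f j) k * x (?h k))" by simp
  then show ?thesis using assms(4) by (simp add: sum.reindex the_inv_into_f_f)
qed

section \<open>Averaging along the diagonals\<close>

text \<open>
  Limits of Cesaro means of a bounded sequence ignore a shift, because consecutive shifted sums
  differ by two terms only.
\<close>
lemma averages_shift_tendsto:
  fixes f :: "nat \<Rightarrow> complex"
  assumes bound: "\<And>n. norm (f n) \<le> B" and N: "strict_mono N"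
    and lim: "(\<lambda>i. (\<Sum>n<N i. f n) / of_nat (N i)) \<longlonglongrightarrow> l"
  shows "(\<lambda>i. (\<Sum>n<N i. f (n + s)) / of_nat (N i)) \<longlonglongrightarrow> l"
proof (induction s)
  case (Suc s)
  have "(\<lambda>i. (f (N i + s) - f s) / of_nat (N i)) \<longlonglongrightarrow> 0"
  proof (rule Lim_null_comparison)
    have "norm (f (N i + s) - f s) \<le> 2 * B" for i
      using norm_triangle_ineq4[of "f (N i + s)" "f s"] bound[of "N i + s"] bound[of s] by linarith
    then show "\<forall>\<^sub>F i in sequentially. norm ((f (N i + s) - f s) / of_nat (N i)) \<le> 2 * B / real (N i)"
      by (intro always_eventually) (auto simp: norm_divide divide_right_mono)
    show "(\<lambda>i. 2 * B / real (N i)) \<longlonglongrightarrow> 0"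
      by (intro tendsto_divide_0[OF tendsto_const] filterlim_at_top_imp_at_infinity
            filterlim_compose[OF filterlim_real_sequentially] filterlim_subseq N)
  qed
  from tendsto_add[OF Suc this]
  have "(\<lambda>i. (\<Sum>n<N i. f (n + s)) / of_nat (N i) + (f (N i + s) - f s) / of_nat (N i)) \<longlonglongrightarrow> l"
    by simp
  moreover have "(\<Sum>n<M. f (n + s)) + (f (M + s) - f s) = (\<Sum>n<M. f (n + Suc s))" for M
    using sum.lessThan_Suc[of "\<lambda>n. f (n + s)" M] sum.lessThan_Suc_shift[of "\<lambda>n. f (n + s)" M]
    by (simp add: algebra_simps)
  ultimately show ?case by (simp only: add_divide_distrib[symmetric])
qed (use lim in simp)

text \<open>
  One subsequence of Cesaro means that works for both residue classes; shift invariance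
  carries the limit from the starting indices 1 and 2 to all others.
\<close>
lemma convergent_averages_by_parity:
  fixes \<psi> :: "nat \<Rightarrow> complex"
  assumes bound: "\<And>n. 1 \<le> n \<Longrightarrow> norm (\<psi> n) \<le> B"
  obtains \<kappa> :: "bool \<Rightarrow> complex" and N :: "nat \<Rightarrow> nat"
  where "strict_mono N"
    "\<And>m. (\<lambda>i. (\<Sum>n<N i. \<psi> (m + 2 * n + 1)) / of_nat (N i)) \<longlonglongrightarrow> \<kappa> (even m)"
proof -
  define avg where "avg e M = (\<Sum>n<M. \<psi> (e + 2 * n + 1)) / of_nat M" for e M :: nat
  have B: "0 \<le> B" using order_trans[OF norm_ge_zero bound[of 1]] by simp
  have avg_bound: "norm (avg e M) \<le> B" for e M
  proof -
    have "norm (\<Sum>n<M. \<psi> (e + 2 * n + 1)) \<le> (\<Sum>n<M. B)"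
      using bound by (intro order_trans[OF norm_sum] sum_mono) auto
    then show ?thesis using B
      by (cases "M = 0") (auto simp: avg_def norm_divide divide_simps mult.commute)
  qed
  have "range (\<lambda>M. (avg 0 M, avg 1 M)) \<subseteq> cball 0 B \<times> cball 0 B"
    using avg_bound by auto
  then have "bounded (range (\<lambda>M. (avg 0 M, avg 1 M)))"
    by (rule bounded_subset[rotated]) (intro bounded_Times bounded_cball)
  then obtain l N where N: "strict_mono N" and lim: "((\<lambda>M. (avg 0 M, avg 1 M)) \<circ> N) \<longlonglongrightarrow> l"
    using bounded_imp_convergent_subsequence by blast
  have lim0: "(\<lambda>i. avg 0 (N i)) \<longlonglongrightarrow> fst l" and lim1: "(\<lambda>i. avg 1 (N i)) \<longlonglongrightarrow> snd l"
    using tendsto_fst[OF lim] tendsto_snd[OF lim] by (auto simp: o_def)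
  show ?thesis
  proof (rule that[of N "\<lambda>b. if b then fst l else snd l", OF N])
    fix m :: nat
    show "(\<lambda>i. (\<Sum>n<N i. \<psi> (m + 2 * n + 1)) / of_nat (N i))
            \<longlonglongrightarrow> (if even m then fst l else snd l)"
    proof (cases "even m")
      case True
      then obtain s where m: "m = 2 * s" by blast
      show ?thesis
        using averages_shift_tendsto[of "\<lambda>n. \<psi> (0 + 2 * n + 1)" B N "fst l" s] lim0 N bound
        by (simp add: avg_def m algebra_simps)
    next
      case False
      then obtain s where m: "m = 2 * s + 1" using oddE by blast
      show ?thesis
        using averages_shift_tendsto[of "\<lambda>n. \<psi> (1 + 2 * n + 1)" B N "snd l" s] lim1 N bound
        by (simp add: avg_def m algebra_simps)
    qed
  qed
qed

text \<open>
  The heart of the matter. Moving \<open>n\<close> steps down the diagonals fixes the Toeplitz part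
  and replaces $\psi_{j+k+1}$ by $\psi_{j+k+2n+1}$, without increasing the bound. Averaging over
  \<open>n\<close> and passing to the limit leaves a matrix with the same bound, in which the Hankel
  part has become a function of the parity of \<open>j + k\<close>. That is also the parity of
  \<open>j - k\<close>, so the limit is itself a Toeplitz matrix.
\<close>
lemma toeplitz_part_section_bounded:
  assumes p: "1 \<le> p" and bound: "\<And>n. 1 \<le> n \<Longrightarrow> norm (\<psi> n) \<le> B"
    and A: "section_bounded p (\<lambda>j k. toeplitz \<phi> j k + hankel \<psi> j k) c"
  obtains \<kappa> :: "bool \<Rightarrow> complex"
  where "section_bounded p (toeplitz (\<lambda>n. \<phi> n + \<kappa> (even n))) c"
proof -
  obtain \<kappa> N where N: "strict_mono N" and
    lim: "\<And>m. (\<lambda>i. (\<Sum>n<N i. \<psi> (m + 2 * n + 1)) / of_nat (N i)) \<longlonglongrightarrow> \<kappa> (even m)"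
    using convergent_averages_by_parity[of \<psi> B, OF bound] by blast
  define S where "S j k n = toeplitz \<phi> (j + n) (k + n) + hankel \<psi> (j + n) (k + n)" for j k n
  have pos: "\<forall>\<^sub>F i in sequentially. 0 < N i"
    using filterlim_subseq[OF N, unfolded filterlim_at_top, rule_format, of 1]
    by eventually_elim simp
  have S_lim: "(\<lambda>i. (\<Sum>n<N i. S j k n) / of_nat (N i))
                 \<longlonglongrightarrow> toeplitz (\<lambda>n. \<phi> n + \<kappa> (even n)) j k" for j k
  proof (rule Lim_transform_eventually)
    show "(\<lambda>i. \<phi> (int j - int k) + (\<Sum>n<N i. \<psi> ((j + k) + 2 * n + 1)) / of_nat (N i))
            \<longlonglongrightarrow> toeplitz (\<lambda>n. \<phi> n + \<kappa> (even n)) j k"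
      using tendsto_add[OF tendsto_const lim[of "j + k"]] by (simp add: toeplitz_def)
    show "\<forall>\<^sub>F i in sequentially.
            \<phi> (int j - int k) + (\<Sum>n<N i. \<psi> ((j + k) + 2 * n + 1)) / of_nat (N i)
              = (\<Sum>n<N i. S j k n) / of_nat (N i)"
      using pos
      by eventually_elim
         (simp add: S_def toeplitz_def hankel_def sum.distrib add_divide_distrib mult_2 add_ac)
  qed
  have "lp_ball p UNIV (c * r) (\<lambda>j. \<Sum>k\<in>K. toeplitz (\<lambda>n. \<phi> n + \<kappa> (even n)) j k * x k)"
    if K: "finite K" "lp_ball p K r x" for K x r
  proof (rule lp_ball_tendsto[OF p])
    show "\<forall>\<^sub>F i in sequentially. lp_ball p UNIV (c * r)
            (\<lambda>j. \<Sum>k\<in>K. ((\<Sum>n<N i. S j k n) / of_nat (N i)) * x k)"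
      using pos
    proof eventually_elim
      case (elim i)
      have "lp_ball p UNIV (c * r) (\<lambda>j. \<Sum>k\<in>K. S j k n * x k)" for n
        unfolding S_def by (rule section_bounded_submatrix[OF p A _ _ K]) auto
      then have "lp_ball p UNIV (c * r)
          (\<lambda>j. (\<Sum>n<N i. \<Sum>k\<in>K. S j k n * x k) / of_nat (card {..<N i}))"
        using elim by (intro lp_ball_average[OF p]) auto
      moreover have "(\<Sum>n<N i. \<Sum>k\<in>K. S j k n * x k) / of_nat (card {..<N i})
          = (\<Sum>k\<in>K. ((\<Sum>n<N i. S j k n) / of_nat (N i)) * x k)" for j
        by (subst sum.swap) (simp add: sum_distrib_right sum_divide_distrib)
      ultimately show ?case by simp
    qed
    show "(\<lambda>i. \<Sum>k\<in>K. ((\<Sum>n<N i. S j k n) / of_nat (N i)) * x k)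
            \<longlonglongrightarrow> (\<Sum>k\<in>K. toeplitz (\<lambda>n. \<phi> n + \<kappa> (even n)) j k * x k)" for j
      by (intro tendsto_sum tendsto_mult tendsto_const S_lim)
  qed simp
  then have "section_bounded p (toeplitz (\<lambda>n. \<phi> n + \<kappa> (even n))) c"
    using A by (simp add: section_bounded_def)
  then show ?thesis by (rule that)
qed

text \<open>
  Every finite window of the Laurent matrix also occurs in the Toeplitz matrix, far down
  the diagonal.
\<close>
lemma laurent_section_bounded_if_toeplitz:
  assumes p: "1 \<le> p" and T: "section_bounded p (toeplitz \<phi>) c"
  shows "section_bounded p (laurent \<phi>) c"
  unfolding section_bounded_def
proof (intro conjI allI impI)
  show c: "0 \<le> c" using T by (simp add: section_bounded_def)
  fix K :: "int set" and x r assume K: "finite K" "lp_ball p K r x"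
  show "lp_ball p UNIV (c * r) (\<lambda>j. \<Sum>k\<in>K. laurent \<phi> j k * x k)"
  proof (rule lp_ball_if_finite_parts)
    show "0 \<le> c * r" using c lp_ball_radius_nonneg[OF K(2)] by simp
    fix F :: "int set" assume "finite F"
    \<comment> \<open>Any \<open>M\<close> with \<open>j + M \<ge> 0\<close> on the finite window will do.\<close>
    define M where "M = (\<Sum>j\<in>F \<union> K. \<bar>j\<bar>)"
    define s where "s j = nat (j + M)" for j
    have s: "int (s j) = j + M" if "j \<in> F \<union> K" for j
      using member_le_sum[OF that, of abs] K(1) \<open>finite F\<close> by (simp add: s_def M_def)
    have inj: "inj_on s (F \<union> K)"
      using s by (metis (no_types, lifting) add_right_cancel inj_onI)
    have "lp_ball p F (c * r) (\<lambda>j. \<Sum>k\<in>K. toeplitz \<phi> (s j) (s k) * x k)"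
      by (rule section_bounded_submatrix[OF p T _ _ K]) (auto intro: inj_on_subset[OF inj])
    then show "lp_ball p F (c * r) (\<lambda>j. \<Sum>k\<in>K. laurent \<phi> j k * x k)"
      by (rule lp_ball_norm_mono[OF p]) (auto simp: toeplitz_def laurent_def s)
  qed
qed

section \<open>Square summability and uniqueness\<close>
lemma section_bounded_laurent_imp_l2:
  assumes "1 \<le> p" "section_bounded p (laurent \<phi>) c"
  shows "(\<lambda>n. (norm (\<phi> n))\<^sup>2) summable_on UNIV"
  using section_bounded_row_or_column_l2[OF assms, of 0]
    summable_on_reindex[of uminus "UNIV :: int set" "\<lambda>n. (norm (\<phi> n))\<^sup>2"]
  by (auto simp: laurent_def o_def surj_uminus)

lemma summable_on_imp_tendsto_0_along_inj:
  fixes f :: "'i \<Rightarrow> real"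
  assumes "f summable_on UNIV" "inj g"
  shows "(\<lambda>n :: nat. f (g n)) \<longlonglongrightarrow> 0"
proof -
  have "f summable_on range g" using assms(1) summable_on_subset_banach by blast
  then have "(\<lambda>n. f (g n)) summable_on UNIV"
    using summable_on_reindex[OF assms(2), of f] by (simp add: o_def)
  then show ?thesis by (intro summable_LIMSEQ_zero summable_on_imp_summable)
qed

lemma section_bounded_hankel_imp_tendsto_0:
  assumes "1 \<le> p" "section_bounded p (hankel \<psi>) c"
  shows "\<psi> \<longlonglongrightarrow> 0"
proof -
  have "(\<lambda>n. (norm (\<psi> (n + 1)))\<^sup>2) summable_on UNIV"
    using section_bounded_row_or_column_l2[OF assms, of 0] by (auto simp: hankel_def)
  from summable_on_imp_tendsto_0_along_inj[OF this inj_on_id]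
  have "(\<lambda>n. sqrt ((norm (\<psi> (n + 1)))\<^sup>2)) \<longlonglongrightarrow> sqrt 0"
    by (intro tendsto_real_sqrt) simp
  then show ?thesis by (simp add: tendsto_norm_zero_iff filterlim_sequentially_Suc)
qed

lemma checkerboard_toeplitz_iff: "checkerboard (toeplitz \<phi>) \<longleftrightarrow> (\<forall>n. \<phi> (n + 2) = \<phi> n)"
proof
  assume *: "checkerboard (toeplitz \<phi>)"
  show "\<forall>n. \<phi> (n + 2) = \<phi> n"
  proof
    fix n :: int
    \<comment> \<open>Write \<open>n\<close> as a difference \<open>j - k\<close> with \<open>k \<ge> 1\<close>, as the antidiagonal step requires.\<close>
    have "toeplitz \<phi> j k = toeplitz \<phi> (j + 1) (k - 1)" if "1 \<le> k" for j k
      using * that by (simp add: checkerboard_def)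
    from this[of "nat (- n) + 1" "nat n + 1"]
    have "toeplitz \<phi> (nat n + 1) (nat (- n) + 1) = toeplitz \<phi> (nat n + 1 + 1) (nat (- n) + 1 - 1)"
      by simp
    moreover have "int (nat n + 1) - int (nat (- n) + 1) = n"
      "int (nat n + 1 + 1) - int (nat (- n) + 1 - 1) = n + 2" by auto
    ultimately show "\<phi> (n + 2) = \<phi> n" by (simp only: toeplitz_def)
  qed
next
  assume *: "\<forall>n. \<phi> (n + 2) = \<phi> n"
  have "toeplitz \<phi> j k = toeplitz \<phi> (j + 1) (k - 1)" if "1 \<le> k" for j k
    using *[rule_format, of "int j - int k"] that by (simp add: toeplitz_def of_nat_diff algebra_simps)
  then show "checkerboard (toeplitz \<phi>)" by (auto simp: checkerboard_def toeplitz_def)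
qed

text \<open>
  The difference of the two periodic parts is the difference of two square-summable sequences,
  so it tends to 0 along \<open>n + 2 * i\<close>, where it is constant.
\<close>
lemma l2_plus_periodic_unique:
  fixes f f' g g' :: "int \<Rightarrow> complex"
  assumes f: "(\<lambda>n. (norm (f n))\<^sup>2) summable_on UNIV" "(\<lambda>n. (norm (f' n))\<^sup>2) summable_on UNIV"
    and g: "\<And>n. g (n + 2) = g n" "\<And>n. g' (n + 2) = g' n"
    and eq: "\<And>n. f n + g n = f' n + g' n"
  shows "f = f'" "g = g'"
proof -
  have null: "(\<lambda>i. h (n + 2 * int i)) \<longlonglongrightarrow> 0"
    if "(\<lambda>n. (norm (h n))\<^sup>2) summable_on UNIV" for h :: "int \<Rightarrow> complex" and n
  proof -
    have "inj (\<lambda>i. n + 2 * int i)" by (auto simp: inj_on_def)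
    from tendsto_real_sqrt[OF summable_on_imp_tendsto_0_along_inj[OF that this]]
    show ?thesis by (simp add: tendsto_norm_zero_iff)
  qed
  have periodic: "h (n + 2 * int i) = h n" if "\<And>n. h (n + 2) = h n" for h :: "int \<Rightarrow> complex" and n i
  proof (induction i)
    case (Suc i)
    then show ?case using that[of "n + 2 * int i"] by (simp add: algebra_simps)
  qed simp
  have gg: "g n = g' n" for n
  proof -
    have "f (n + 2 * int i) - f' (n + 2 * int i) = g' n - g n" for i
      using eq[of "n + 2 * int i"] periodic[of g n i] periodic[of g' n i] g by (simp add: algebra_simps)
    moreover have "(\<lambda>i. f (n + 2 * int i) - f' (n + 2 * int i)) \<longlonglongrightarrow> 0"
      using tendsto_diff[OF null[OF f(1)] null[OF f(2)]] by simp
    ultimately have "(\<lambda>i :: nat. g' n - g n) \<longlonglongrightarrow> 0" by simp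
    then show ?thesis by (simp add: LIMSEQ_const_iff)
  qed
  then show "g = g'" by auto
  show "f = f'" using eq gg by auto
qed

section \<open>Square-summable sequences are Fourier sequences\<close>

text \<open>
  A partition of the integers into finite blocks that carry geometrically decreasing mass;
  \<open>b\<close> assigns to each integer the number of its block.
\<close>
lemma summable_on_UNIV_geometric_blocks:
  fixes f :: "int \<Rightarrow> real"
  assumes f: "f summable_on UNIV" and nonneg: "\<And>n. 0 \<le> f n"
  obtains b :: "int \<Rightarrow> nat" and C :: real
  where "0 < C" "\<And>k. finite {n. b n = k}" "\<And>k. (\<Sum>n | b n = k. f n) \<le> C * (1 / 4) ^ k"
proof -
  have "\<exists>G. finite G \<and> (\<forall>F. finite F \<longrightarrow> F \<inter> G = {} \<longrightarrow> sum f F \<le> e)" if "0 < e" for e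
  proof -
    have "\<forall>\<^sub>F G in finite_subsets_at_top UNIV. dist (sum f G) (infsum f UNIV) < e"
      using tendstoD[OF infsum_tendsto[OF f] that] .
    then obtain G where G: "finite G" "dist (sum f G) (infsum f UNIV) < e"
      unfolding eventually_finite_subsets_at_top by blast
    have "sum f F \<le> e" if "finite F" "F \<inter> G = {}" for F
    proof -
      have "sum f F + sum f G = sum f (F \<union> G)" using that G by (simp add: sum.union_disjoint)
      also have "\<dots> \<le> infsum f UNIV"
        by (rule finite_sum_le_infsum[OF f]) (use that G nonneg in auto)
      finally show ?thesis using G(2) by (simp add: dist_real_def)
    qed
    then show ?thesis using G(1) by blast
  qed
  then have "\<forall>k :: nat. \<exists>G. finite G \<and> (\<forall>F. finite F \<longrightarrow> F \<inter> G = {} \<longrightarrow> sum f F \<le> (1 / 4) ^ k)"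
    by simp
  then obtain G where G: "\<And>k. finite (G k)"
    "\<And>k F. finite F \<Longrightarrow> F \<inter> G k = {} \<Longrightarrow> sum f F \<le> (1 / 4) ^ (k :: nat)"
    by metis
  \<comment> \<open>The intervals guarantee that every integer is reached; the sets \<open>H k\<close> need not increase,
    since block \<open>Suc k\<close> only has to avoid \<open>G k\<close>.\<close>
  define H where "H k = G k \<union> {- int k .. int k}" for k
  define b where "b n = (LEAST k. n \<in> H k)" for n
  have b: "n \<in> H (b n)" for n
    unfolding b_def by (rule LeastI[of _ "nat \<bar>n\<bar>"]) (auto simp: H_def)
  have fin: "finite {n. b n = k}" for k
  proof (rule finite_subset)
    show "{n. b n = k} \<subseteq> H k" using b by auto
    show "finite (H k)" using G(1) by (simp add: H_def)
  qed
  have Suc: "(\<Sum>n | b n = Suc k. f n) \<le> (1 / 4) ^ k" for k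
  proof (rule G(2)[OF fin])
    show "{n. b n = Suc k} \<inter> G k = {}"
      using not_less_Least[of k "\<lambda>k. _ \<in> H k"] by (fastforce simp: b_def H_def)
  qed
  \<comment> \<open>The 4 makes up for the index shift in block \<open>Suc k\<close>; block 0 has no bound but its own sum.\<close>
  define C where "C = max 4 (\<Sum>n | b n = 0. f n)"
  show ?thesis
  proof (rule that[of C b])
    show "(\<Sum>n | b n = k. f n) \<le> C * (1 / 4) ^ k" for k
    proof (cases k)
      case (Suc l)
      have "4 * (1 / 4) ^ k \<le> C * (1 / 4 :: real) ^ k"
        by (intro mult_right_mono) (auto simp: C_def)
      then have "(1 / 4) ^ l \<le> C * (1 / 4 :: real) ^ k" by (simp add: Suc)
      then show ?thesis using \<open>(\<Sum>n | b n = Suc l. f n) \<le> (1 / 4) ^ l\<close> unfolding Suc by (rule order_trans[rotated])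
    qed (simp add: C_def)
  qed (auto simp: C_def fin)
qed

lemma AE_summable_if_summable_integral_norm:
  fixes f :: "nat \<Rightarrow> 'a \<Rightarrow> 'b :: {banach, second_countable_topology}"
  assumes [measurable]: "\<And>i. integrable M (f i)" and "summable (\<lambda>i. \<integral>x. norm (f i x) \<partial>M)"
  shows "AE x in M. summable (\<lambda>i. norm (f i x))"
proof -
  have "(\<integral>\<^sup>+ x. (\<Sum>i. ennreal (norm (f i x))) \<partial>M) = (\<Sum>i. \<integral>\<^sup>+ x. ennreal (norm (f i x)) \<partial>M)"
    by (intro nn_integral_suminf) auto
  also have "\<dots> = (\<Sum>i. ennreal (\<integral>x. norm (f i x) \<partial>M))"
    by (intro arg_cong[where f = suminf] ext nn_integral_eq_integral integrable_norm assms) auto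
  also have "\<dots> \<noteq> \<infinity>"
    using assms(2) by (simp add: ennreal_suminf_neq_top)
  finally have "AE x in M. (\<Sum>i. ennreal (norm (f i x))) \<noteq> \<infinity>"
    by (intro nn_integral_PInf_AE) auto
  then show ?thesis
    by eventually_elim (auto intro: summable_suminf_not_top)
qed

lemma has_integral_cis:
  "((\<lambda>t. cis (of_int n * t)) has_integral (if n = 0 then of_real (2 * pi) else 0)) {0..2 * pi}"
proof (cases "n = 0")
  case True
  then show ?thesis using has_integral_const_real[of "1 :: complex" 0 "2 * pi"] by (simp add: scaleR_conv_of_real)
next
  case False
  have "((\<lambda>t. cis (of_int n * t)) has_integral
          (cis (of_int n * (2 * pi)) / (\<i> * of_int n) - cis (of_int n * 0) / (\<i> * of_int n))) {0..2 * pi}"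
  proof (rule fundamental_theorem_of_calculus)
    fix t :: real
    have "((\<lambda>t. cis (of_int n * t)) has_vector_derivative (of_int n *\<^sub>R (\<i> * cis (of_int n * t)))) (at t within {0..2 * pi})"
      unfolding cis_conv_exp
      by (rule has_vector_derivative_eq_rhs)
         (auto intro!: derivative_eq_intros has_vector_derivative_real_field simp: scaleR_conv_of_real)
    from has_vector_derivative_divide[OF this, of "\<i> * of_int n"]
    show "((\<lambda>t. cis (of_int n * t) / (\<i> * of_int n)) has_vector_derivative cis (of_int n * t)) (at t within {0..2 * pi})"
      using False by (simp add: scaleR_conv_of_real)
  qed auto
  moreover have "cis (of_int n * (2 * pi)) = 1"
    using cis_multiple_2pi[of "of_int n"] by (simp add: mult_ac)
  ultimately show ?thesis using False by simp
qed

lemma trig_poly_coefficient_has_integral: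
  fixes \<phi> :: "int \<Rightarrow> complex"
  assumes "finite B"
  shows "((\<lambda>t. (\<Sum>n\<in>B. \<phi> n * cis (of_int n * t)) * cis (- (of_int m * t)))
            has_integral (if m \<in> B then of_real (2 * pi) * \<phi> m else 0)) {0..2 * pi}"
proof -
  have "((\<lambda>t. \<Sum>n\<in>B. \<phi> n * cis (of_int (n - m) * t))
          has_integral (\<Sum>n\<in>B. \<phi> n * (if n - m = 0 then of_real (2 * pi) else 0))) {0..2 * pi}"
    by (intro has_integral_sum[OF assms] has_integral_mult_right has_integral_cis)
  moreover have "(\<Sum>n\<in>B. \<phi> n * cis (of_int (n - m) * t))
      = (\<Sum>n\<in>B. \<phi> n * cis (of_int n * t)) * cis (- (of_int m * t))" for t
    by (simp add: sum_distrib_right mult.assoc cis_mult left_diff_distrib)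
  moreover have "(\<Sum>n\<in>B. \<phi> n * (if n - m = 0 then of_real (2 * pi) else 0))
      = (if m \<in> B then of_real (2 * pi) * \<phi> m else 0)"
  proof -
    have "(\<Sum>n\<in>B. \<phi> n * (if n - m = 0 then of_real (2 * pi) else 0))
        = (\<Sum>n\<in>B. if n = m then of_real (2 * pi) * \<phi> n else 0)"
      by (intro sum.cong refl) simp
    then show ?thesis using assms by simp
  qed
  ultimately show ?thesis by simp
qed

lemma trig_poly_parseval:
  fixes \<phi> :: "int \<Rightarrow> complex"
  assumes "finite B"
  shows "((\<lambda>t. (norm (\<Sum>n\<in>B. \<phi> n * cis (of_int n * t)))\<^sup>2)
            has_integral (2 * pi * (\<Sum>n\<in>B. (norm (\<phi> n))\<^sup>2))) {0..2 * pi}"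
proof -
  let ?P = "\<lambda>t. \<Sum>n\<in>B. \<phi> n * cis (of_int n * t)"
  have "((\<lambda>t. \<Sum>m\<in>B. cnj (\<phi> m) * (?P t * cis (- (of_int m * t))))
          has_integral (\<Sum>m\<in>B. cnj (\<phi> m) * (if m \<in> B then of_real (2 * pi) * \<phi> m else 0))) {0..2 * pi}"
    by (intro has_integral_sum[OF assms] has_integral_mult_right trig_poly_coefficient_has_integral assms)
  moreover have "(\<Sum>m\<in>B. cnj (\<phi> m) * (?P t * cis (- (of_int m * t)))) = of_real ((norm (?P t))\<^sup>2)" for t
  proof -
    have "cnj (?P t) = (\<Sum>m\<in>B. cnj (\<phi> m) * cis (- (of_int m * t)))"
      by (simp add: cis_cnj)
    then show ?thesis
      unfolding complex_norm_square by (simp only: sum_distrib_left mult.left_commute)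
  qed
  moreover have "(\<Sum>m\<in>B. cnj (\<phi> m) * (if m \<in> B then of_real (2 * pi) * \<phi> m else 0))
      = of_real (2 * pi * (\<Sum>n\<in>B. (norm (\<phi> n))\<^sup>2))"
  proof -
    have "(\<Sum>m\<in>B. cnj (\<phi> m) * (if m \<in> B then of_real (2 * pi) * \<phi> m else 0))
        = (\<Sum>m\<in>B. of_real (2 * pi) * of_real ((norm (\<phi> m))\<^sup>2))"
      by (intro sum.cong refl, subst complex_norm_square) simp
    then show ?thesis by (simp add: sum_distrib_left)
  qed
  ultimately have "((\<lambda>t. complex_of_real ((norm (?P t))\<^sup>2))
      has_integral complex_of_real (2 * pi * (\<Sum>n\<in>B. (norm (\<phi> n))\<^sup>2))) {0..2 * pi}"
    by (simp only:)
  from has_integral_Re[OF this] show ?thesis by (simp only: Re_complex_of_real)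
qed

text \<open>
  $L^1$ against $L^2$ by $2 |P| \le e + |P|^2 / e$ and Parseval, in place of the
  Cauchy--Schwarz inequality for integrals.
\<close>
lemma trig_poly_L1_bound:
  fixes \<phi> :: "int \<Rightarrow> complex"
  assumes B: "finite B" and e: "0 < e" "(\<Sum>n\<in>B. (norm (\<phi> n))\<^sup>2) \<le> e\<^sup>2"
  shows "(LINT t:{0..2 * pi}|lebesgue. norm (\<Sum>n\<in>B. \<phi> n * cis (of_int n * t))) \<le> 2 * pi * e"
proof -
  let ?P = "\<lambda>t. \<Sum>n\<in>B. \<phi> n * cis (of_int n * t)"
  have cont: "continuous_on {0..2 * pi} (\<lambda>t. norm (?P t))" by (intro continuous_intros)
  have "set_integrable lebesgue {0..2 * pi} (\<lambda>t. norm (?P t))"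
    using absolutely_integrable_continuous_real[OF cont] .
  from set_lebesgue_integral_eq_integral(2)[OF this]
  have "(LINT t:{0..2 * pi}|lebesgue. norm (?P t)) = integral {0..2 * pi} (\<lambda>t. norm (?P t))" .
  also have "\<dots> \<le> (2 * pi * e + (2 * pi * (\<Sum>n\<in>B. (norm (\<phi> n))\<^sup>2)) / e) / 2"
  proof (rule has_integral_le)
    show "((\<lambda>t. norm (?P t)) has_integral integral {0..2 * pi} (\<lambda>t. norm (?P t))) {0..2 * pi}"
      using cont by (intro integrable_integral integrable_continuous_real)
    show "((\<lambda>t. (e + (norm (?P t))\<^sup>2 / e) / 2)
             has_integral (2 * pi * e + (2 * pi * (\<Sum>n\<in>B. (norm (\<phi> n))\<^sup>2)) / e) / 2) {0..2 * pi}"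
      using has_integral_const_real[of e 0 "2 * pi"]
      by (intro has_integral_divide has_integral_add trig_poly_parseval[OF B]) simp
    show "norm (?P t) \<le> (e + (norm (?P t))\<^sup>2 / e) / 2" for t
      using sum_squares_bound[of "norm (?P t)" e] e by (simp add: field_simps power2_eq_square)
  qed
  also have "\<dots> \<le> (2 * pi * e + (2 * pi * e\<^sup>2) / e) / 2"
    using e by (intro divide_right_mono add_left_mono mult_left_mono) auto
  also have "\<dots> = 2 * pi * e" using e by (simp add: power2_eq_square)
  finally show ?thesis .
qed

text \<open>
  The partial sums over the blocks form a series of trigonometric polynomials whose $L^1$ norms
  decrease geometrically. Such a series may be integrated termwise against every character,
  and each frequency lies in exactly one block.
\<close>
lemma riesz_fischer_L1:
  fixes \<phi> :: "int \<Rightarrow> complex"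
  assumes "(\<lambda>n. (norm (\<phi> n))\<^sup>2) summable_on UNIV"
  shows "\<exists>a\<in>L1_circle. fourier_coeff a = \<phi>"
proof -
  obtain b C where C: "0 < C" and fin: "\<And>k. finite {n. b n = k}"
    and block: "\<And>k. (\<Sum>n | b n = k. (norm (\<phi> n))\<^sup>2) \<le> C * (1 / 4) ^ k"
    using summable_on_UNIV_geometric_blocks[OF assms zero_le_power2] by metis
  define P where "P k t = (\<Sum>n | b n = k. \<phi> n * cis (of_int n * t))" for k t
  define a where "a z = (\<Sum>k. \<Sum>n | b n = k. \<phi> n * z powi n)" for z
  have a: "a (cis t) = (\<Sum>k. P k t)" for t
    by (simp add: a_def P_def cis_power_int)
  have P_abs: "set_integrable lebesgue {0..2 * pi} (\<lambda>t. P k t * cis (- (of_int m * t)))" for k m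
    unfolding P_def by (intro absolutely_integrable_continuous_real continuous_intros)
  have L1: "(LINT t:{0..2 * pi}|lebesgue. norm (P k t)) \<le> 2 * pi * (sqrt C * (1 / 2) ^ k)" for k
    unfolding P_def
  proof (rule trig_poly_L1_bound[OF fin])
    have "((1 / 2) ^ k)\<^sup>2 = (1 / 4 :: real) ^ k"
      by (simp add: power_mult[symmetric] mult.commute[of k 2] power_mult power_divide)
    then show "(\<Sum>n | b n = k. (norm (\<phi> n))\<^sup>2) \<le> (sqrt C * (1 / 2) ^ k)\<^sup>2"
      using block[of k] C by (simp add: power_mult_distrib)
  qed (use C in simp)
  \<comment> \<open>The series multiplied by the character of frequency \<open>- m\<close>; \<open>m = 0\<close> gives the
    integrability of \<open>a\<close> itself.\<close>
  define f where "f m k t = indicator {0..2 * pi} t *\<^sub>R (P k t * cis (- (of_int m * t)))"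
    for m :: int and k and t :: real
  have f_int: "integrable lebesgue (f m k)" for m k
    using P_abs[of k m] by (simp add: set_integrable_def f_def[abs_def])
  have f_sum: "summable (\<lambda>k. \<integral>t. norm (f m k t) \<partial>lebesgue)" for m
  proof (rule summable_comparison_test')
    show "summable (\<lambda>k. 2 * pi * (sqrt C * (1 / 2 :: real) ^ k))"
      by (intro summable_mult summable_geometric) simp
    have "norm (f m k t) = indicator {0..2 * pi} t *\<^sub>R norm (P k t)" for k t
      by (simp add: f_def norm_mult)
    then show "norm (\<integral>t. norm (f m k t) \<partial>lebesgue) \<le> 2 * pi * (sqrt C * (1 / 2) ^ k)" if "0 \<le> k" for k
      using L1[of k] by (simp add: set_lebesgue_integral_def)
  qed
  note f_AE = AE_summable_if_summable_integral_norm[OF f_int f_sum]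
  have f_suminf: "(\<Sum>k. f m k t) = indicator {0..2 * pi} t *\<^sub>R (a (cis t) * cis (- (of_int m * t)))"
    if "summable (\<lambda>k. norm (f m k t))" for m t
  proof (cases "t \<in> {0..2 * pi}")
    case True
    then have "summable (\<lambda>k. P k t)"
      using summable_norm_cancel that by (fastforce simp: f_def norm_mult)
    then show ?thesis using True by (simp add: f_def a suminf_mult2)
  qed (simp add: f_def)
  have P_borel [measurable]: "P k \<in> borel_measurable borel" for k
    unfolding P_def by (intro borel_measurable_continuous_onI continuous_intros)
  have a_meas: "(\<lambda>t. indicator {0..2 * pi} t *\<^sub>R (a (cis t) * cis (- (of_int m * t))))
      \<in> borel_measurable lebesgue" for m
  proof -
    have [measurable]: "(\<lambda>t. cis (- (of_int m * t))) \<in> borel_measurable borel"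
      by (intro borel_measurable_continuous_onI continuous_intros)
    have "(\<lambda>t. indicator {0..2 * pi} t *\<^sub>R (a (cis t) * cis (- (of_int m * t)))) \<in> borel_measurable lborel"
      unfolding a by measurable
    then show ?thesis by (rule measurable_completion)
  qed
  have a_AE: "AE t in lebesgue. (\<Sum>k. f m k t)
      = indicator {0..2 * pi} t *\<^sub>R (a (cis t) * cis (- (of_int m * t)))" for m
    using f_AE[of m] by eventually_elim (rule f_suminf)
  have "integrable lebesgue (\<lambda>t. indicator {0..2 * pi} t *\<^sub>R (a (cis t) * cis (- (of_int m * t))))" for m
    by (rule integrable_cong_AE_imp[OF integrable_suminf[OF f_int f_AE f_sum] a_meas])
       (use a_AE[of m] in \<open>auto elim: eventually_mono\<close>)
  from this[of 0] have a_L1: "a \<in> L1_circle"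
    by (simp add: L1_circle_def set_integrable_def)
  have "fourier_coeff a m = \<phi> m" for m
  proof -
    have f_coeff: "integral\<^sup>L lebesgue (f m k) = (if k = b m then of_real (2 * pi) * \<phi> m else 0)" for k
    proof -
      have "integral\<^sup>L lebesgue (f m k) = integral {0..2 * pi} (\<lambda>t. P k t * cis (- (of_int m * t)))"
        using set_lebesgue_integral_eq_integral(2)[OF P_abs[of k m]]
        by (simp add: set_lebesgue_integral_def f_def[abs_def])
      also have "\<dots> = (if k = b m then of_real (2 * pi) * \<phi> m else 0)"
        using integral_unique[OF trig_poly_coefficient_has_integral[OF fin[of k], of \<phi> m]]
        by (auto simp: P_def)
      finally show ?thesis .
    qed
    have "(LINT t:{0..2 * pi}|lebesgue. a (cis t) * cis (- (of_int m * t)))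
        = (\<integral>t. (\<Sum>k. f m k t) \<partial>lebesgue)"
      unfolding set_lebesgue_integral_def
      using a_AE[of m] a_meas borel_measurable_integrable[OF integrable_suminf[OF f_int f_AE f_sum]]
      by (intro integral_cong_AE) (auto elim: eventually_mono)
    also have "\<dots> = of_real (2 * pi) * \<phi> m"
      unfolding integral_suminf[OF f_int f_AE f_sum] f_coeff
      using suminf_finite[of "{b m}" "\<lambda>k. if k = b m then of_real (2 * pi) * \<phi> m else 0"] by simp
    finally show ?thesis by (simp add: fourier_coeff_def)
  qed
  then show ?thesis using a_L1 by blast
qed

section \<open>The decomposition theorem\<close>

theorem theorem5:
  fixes p :: ennreal and \<phi> :: "int \<Rightarrow> complex" and \<psi> :: "nat \<Rightarrow> complex"
  assumes "1 \<le> p"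
    and "\<phi> \<in> ell \<infinity> UNIV"
    and "\<psi> \<in> ell \<infinity> {1..}"
    and "bounded_matrix p UNIV (\<lambda>j k. toeplitz \<phi> j k + hankel \<psi> j k)"
  shows "\<exists>\<phi>1 \<phi>2 \<psi>1 \<psi>2.
           toeplitz_decomp p \<phi> \<phi>1 \<phi>2 \<and>
           hankel_decomp p \<phi>2 \<psi> \<psi>1 \<psi>2 \<and>
           (\<forall>\<phi>1' \<phi>2'. toeplitz_decomp p \<phi> \<phi>1' \<phi>2' \<longrightarrow> \<phi>1' = \<phi>1 \<and> \<phi>2' = \<phi>2) \<and>
           (\<forall>\<psi>1' \<psi>2'. hankel_decomp p \<phi>2 \<psi> \<psi>1' \<psi>2' \<longrightarrow>
              (\<forall>n\<ge>1. \<psi>1' n = \<psi>1 n \<and> \<psi>2' n = \<psi>2 n))"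
proof -
  note p = assms(1)
  obtain B where B: "\<And>n. 1 \<le> n \<Longrightarrow> norm (\<psi> n) \<le> B"
    using assms(3) by (auto simp: ell_def bdd_above_def)
  obtain c where A: "section_bounded p (\<lambda>j k. toeplitz \<phi> j k + hankel \<psi> j k) c"
    using assms(4) bounded_matrix_iff_section_bounded[OF p] by blast
  obtain \<kappa> :: "bool \<Rightarrow> complex"
    where T: "section_bounded p (toeplitz (\<lambda>n. \<phi> n + \<kappa> (even n))) c"
    by (rule toeplitz_part_section_bounded[OF p B A])
  define \<phi>1 where "\<phi>1 n = \<phi> n + \<kappa> (even n)" for n
  define \<phi>2 where "\<phi>2 n = - \<kappa> (even n)" for n :: int
  \<comment> \<open>The entry $\psi_n$ of the Hankel matrix sits where $j + k = n - 1$, which reverses the parity.\<close>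
  define \<psi>1 where "\<psi>1 n = \<psi> n - \<kappa> (odd n)" for n
  define \<psi>2 where "\<psi>2 n = \<kappa> (odd n)" for n :: nat

  have multiplier_l2: "(\<lambda>n. (norm (fourier_coeff a n))\<^sup>2) summable_on UNIV"
    if "a \<in> multipliers p" for a
    using that bounded_matrix_iff_section_bounded[OF p] section_bounded_laurent_imp_l2[OF p]
    by (auto simp: multipliers_def)

  have "section_bounded p (laurent \<phi>1) c"
    using laurent_section_bounded_if_toeplitz[OF p T] by (simp add: \<phi>1_def[abs_def])
  then have L: "bounded_matrix p UNIV (laurent \<phi>1)" and l2: "(\<lambda>n. (norm (\<phi>1 n))\<^sup>2) summable_on UNIV"
    using bounded_matrix_iff_section_bounded[OF p] section_bounded_laurent_imp_l2[OF p] by blast+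
  obtain a where a: "a \<in> L1_circle" "fourier_coeff a = \<phi>1" using riesz_fischer_L1[OF l2] by blast
  have \<phi>_decomp: "toeplitz_decomp p \<phi> \<phi>1 \<phi>2"
    unfolding toeplitz_decomp_def checkerboard_toeplitz_iff
  proof (intro conjI allI bexI[of _ a])
    show "a \<in> multipliers p" using a L by (simp add: multipliers_def)
  qed (use a in \<open>auto simp: \<phi>1_def \<phi>2_def\<close>)

  have "hankel \<psi>1 = (\<lambda>j k. toeplitz \<phi> j k + hankel \<psi> j k - toeplitz (\<lambda>n. \<phi> n + \<kappa> (even n)) j k)"
    by (simp add: fun_eq_iff hankel_def toeplitz_def \<psi>1_def)
  with section_bounded_diff[OF p A T] have H: "section_bounded p (hankel \<psi>1) (2 * (c + c))"
    by simp
  have \<psi>_decomp: "hankel_decomp p \<phi>2 \<psi> \<psi>1 \<psi>2"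
    unfolding hankel_decomp_def
    using H bounded_matrix_iff_section_bounded[OF p, of "hankel \<psi>1"]
      section_bounded_hankel_imp_tendsto_0[OF p H]
    by (auto simp: hankel_def toeplitz_def \<psi>1_def \<psi>2_def \<phi>2_def)

  have \<phi>_unique: "\<phi>1' = \<phi>1 \<and> \<phi>2' = \<phi>2" if "toeplitz_decomp p \<phi> \<phi>1' \<phi>2'" for \<phi>1' \<phi>2'
  proof -
    have "(\<lambda>n. (norm (\<phi>1' n))\<^sup>2) summable_on UNIV"
      using that multiplier_l2 by (auto simp: toeplitz_decomp_def)
    moreover have "\<phi>2' (n + 2) = \<phi>2' n" "\<phi>2 (n + 2) = \<phi>2 n" "\<phi>1' n + \<phi>2' n = \<phi>1 n + \<phi>2 n" for n
      using that \<phi>_decomp by (auto simp: toeplitz_decomp_def checkerboard_toeplitz_iff)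
    ultimately show ?thesis
      using l2_plus_periodic_unique[OF _ l2, of \<phi>1' \<phi>2' \<phi>2] by blast
  qed
  have \<psi>_unique: "\<psi>1' n = \<psi>1 n \<and> \<psi>2' n = \<psi>2 n"
    if "hankel_decomp p \<phi>2 \<psi> \<psi>1' \<psi>2'" "1 \<le> n" for \<psi>1' \<psi>2' n
  proof -
    \<comment> \<open>Column 0 of a Hankel matrix already displays its whole sequence.\<close>
    have "hankel \<psi>2' (n - 1) 0 = hankel \<psi>2 (n - 1) 0"
      using that(1) \<psi>_decomp unfolding hankel_decomp_def by metis
    then have "\<psi>2' n = \<psi>2 n" using that(2) by (simp add: hankel_def)
    moreover have "\<psi>1' n + \<psi>2' n = \<psi>1 n + \<psi>2 n"
      using that \<psi>_decomp unfolding hankel_decomp_def by metis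
    ultimately show ?thesis by simp
  qed
  show ?thesis
    using \<phi>_decomp \<psi>_decomp \<phi>_unique \<psi>_unique by blast
qed

end
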